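(* For every integer $n>2$, the generic determinant $\det_n=\det\big((x_{i,j})_{i,j=1}^n\big)$, regarded as a homogeneous form of degree $n$ in the $n^2$ variables $x_{i,j}$ over $\mathbb{C}$, is not a direct sum.
   Context: A form $F\in S^dV$ ($V$ a finite-dimensional complex vector space) is a direct sum if there are subspaces $V_1,V_2\subset V$ with $V=V_1\oplus V_2$ and nonzero $F_1\in S^dV_1$, $F_2\in S^dV_2$ such that $F=F_1+F_2$. Here $V$ is the $n^2$-dimensional space with basis the variables $x_{i,j}$, $1\le i,j\le n$. *)

theory Defs
  imports "HOL-Library.Poly_Mapping" "Jordan_Normal_Form.Determinant"
begin

text \<open>
  The symmetric algebra of the complex vector space with basis \<open>'x\<close> is realised as the
  polynomial ring in the variables \<open>'x\<close>: a polynomial is a finitely supported map from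
  exponent vectors to coefficients.
\<close>

type_synonym 'x cpoly = "('x \<Rightarrow>\<^sub>0 nat) \<Rightarrow>\<^sub>0 complex"

definition Var :: "'x \<Rightarrow> 'x cpoly" where
  "Var x = Poly_Mapping.single (Poly_Mapping.single x 1) 1"

definition scale :: "complex \<Rightarrow> 'x cpoly \<Rightarrow> 'x cpoly" where
  "scale c p = Poly_Mapping.single 0 c * p"

global_interpretation cpoly: vector_space scale
  by unfold_locales
    (simp_all add: scale_def algebra_simps single_add mult_single flip: mult.assoc)

text \<open>
  For a subspace \<open>W\<close> of the linear forms, \<open>S\<^sup>d W\<close> is spanned by the \<open>d\<close>-fold products of
  elements of \<open>W\<close>; for \<open>W \<subseteq> V\<close> it is thereby a subspace of \<open>S\<^sup>d V\<close>.
\<close>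

definition Sym :: "nat \<Rightarrow> 'x cpoly set \<Rightarrow> 'x cpoly set" where
  "Sym d W = cpoly.span {prod_list ws | ws. length ws = d \<and> set ws \<subseteq> W}"

definition internal_direct_sum :: "'x cpoly set \<Rightarrow> 'x cpoly set \<Rightarrow> 'x cpoly set \<Rightarrow> bool" where
  "internal_direct_sum V V1 V2 \<longleftrightarrow>
     cpoly.subspace V1 \<and> cpoly.subspace V2 \<and>
     V = {u + v | u v. u \<in> V1 \<and> v \<in> V2} \<and> V1 \<inter> V2 = {0}"

definition is_direct_sum :: "nat \<Rightarrow> 'x cpoly set \<Rightarrow> 'x cpoly \<Rightarrow> bool" where
  "is_direct_sum d V F \<longleftrightarrow>
     (\<exists>V1 V2. internal_direct_sum V V1 V2 \<and>
       (\<exists>F1 \<in> Sym d V1. \<exists>F2 \<in> Sym d V2. F1 \<noteq> 0 \<and> F2 \<noteq> 0 \<and> F = F1 + F2))"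

text \<open>Rows and columns are numbered from \<open>0\<close> to \<open>n - 1\<close>, as usual for type \<open>mat\<close>.\<close>

definition matrix_forms :: "nat \<Rightarrow> (nat \<times> nat) cpoly set" where
  "matrix_forms n = cpoly.span (Var ` ({..<n} \<times> {..<n}))"

definition generic_det :: "nat \<Rightarrow> (nat \<times> nat) cpoly" where
  "generic_det n = det (mat n n (\<lambda>(i, j). Var (i, j)))"

text \<open>Thus \<open>generic_det n\<close> is a form of degree \<open>n\<close> on the span of the \<open>n\<^sup>2\<close> variables.\<close>

lemma generic_det_in_Sym: "generic_det n \<in> Sym n (matrix_forms n)"
proof -
  have *: "signof p * (\<Prod>i = 0..<n. mat n n (\<lambda>(i, j). Var (i, j)) $$ (i, p i))
      \<in> Sym n (matrix_forms n)" if p: "p permutes {0..<n}" for p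
  proof -
    let ?ws = "map (\<lambda>i. Var (i, p i)) [0..<n]"
    have lt: "p i < n" if "i < n" for i
      using permutes_in_image[OF p, of i] that by simp
    have "(\<Prod>i = 0..<n. mat n n (\<lambda>(i, j). Var (i, j)) $$ (i, p i)) = (\<Prod>i = 0..<n. Var (i, p i))"
      by (rule prod.cong) (auto simp: lt)
    also have "\<dots> = prod_list ?ws"
      by (simp add: prod.distinct_set_conv_list[symmetric])
    finally have eq: "(\<Prod>i = 0..<n. mat n n (\<lambda>(i, j). Var (i, j)) $$ (i, p i)) = prod_list ?ws" .
    have "prod_list ?ws \<in> {prod_list ws | ws. length ws = n \<and> set ws \<subseteq> matrix_forms n}"
      by (intro CollectI exI[of _ ?ws])
        (auto simp: matrix_forms_def lt intro!: cpoly.span_base)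
    then have mem: "prod_list ?ws \<in> Sym n (matrix_forms n)"
      unfolding Sym_def by (rule cpoly.span_base)
    then have "- prod_list ?ws \<in> Sym n (matrix_forms n)"
      unfolding Sym_def by (rule cpoly.span_neg)
    with mem show ?thesis
      unfolding eq by (cases "sign p = 1") (auto simp: sign_def)
  qed
  show ?thesis
    unfolding generic_det_def det_def
    using * unfolding Sym_def by (auto intro!: cpoly.span_sum)
qed

end

theory Submission
  imports Defs
begin

text \<open>
  The determinant is viewed as a function of a complex matrix. Let \<open>\<pi>\<close> be the projection of the
  linear forms onto \<open>V1\<close> along \<open>V2\<close>, and let \<open>P\<close> be the dual map on matrices, so that
  \<open>w (P x) = (\<pi> w) x\<close>. Translating the argument by a vector \<open>b - P b\<close> does not change the value of
  a form in \<open>V1\<close>, and translating it by \<open>P a\<close> does not change the value of a form in \<open>V2\<close>. Hence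
  \<open>det = F1 + F2\<close> has no mixed second differences along such pairs:
  \<open>det (x + P a + (b - P b)) + det x = det (x + P a) + det (x + (b - P b))\<close> for every \<open>x\<close>.

  If \<open>x\<close> is a large multiple of a partial permutation matrix of rank \<open>n - 2\<close>, the leading term of
  this identity only involves the \<open>2 \<times> 2\<close> minor complementary to that partial permutation. Hence
  \<open>P a\<close> and \<open>b - P b\<close> are orthogonal for the symmetric bilinear form polarising any \<open>2 \<times> 2\<close>
  minor (\<open>polarised_minor_eq_0\<close>). In other words, \<open>P\<close> is self-adjoint for all these forms at once.

  For \<open>n > 2\<close> this leaves little room (\<open>self_adjoint_for_minors_imp_scalar\<close>). Two distinct
  positions can be separated by the rows and columns of a \<open>2 \<times> 2\<close> minor, so each matrix unit is an
  eigenvector of \<open>P\<close>. Two positions in different rows and columns have the same eigenvalue, and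
  any two positions have a common partner of this kind. So \<open>P\<close> is a scalar
  (\<open>mixed_additive_det_imp_scalar\<close>), which makes \<open>V1\<close> or \<open>V2\<close> zero, and with it \<open>F1\<close> or \<open>F2\<close>.
  For \<open>n = 2\<close> both choices are impossible, and the determinant, a nondegenerate quadratic form in
  four variables, is indeed a direct sum.
\<close>

section \<open>Evaluation of polynomials\<close>

definition monom_eval :: "('x \<Rightarrow> complex) \<Rightarrow> ('x \<Rightarrow>\<^sub>0 nat) \<Rightarrow> complex" where
  "monom_eval v m = (\<Prod>x\<in>Poly_Mapping.keys m. v x ^ Poly_Mapping.lookup m x)"

definition poly_eval :: "('x \<Rightarrow> complex) \<Rightarrow> 'x cpoly \<Rightarrow> complex" where
  "poly_eval v p = (\<Sum>m\<in>Poly_Mapping.keys p. Poly_Mapping.lookup p m * monom_eval v m)"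

lemma monom_eval_superset:
  assumes "finite A" "Poly_Mapping.keys m \<subseteq> A"
  shows "monom_eval v m = (\<Prod>x\<in>A. v x ^ Poly_Mapping.lookup m x)"
  unfolding monom_eval_def
  by (rule prod.mono_neutral_left) (use assms in \<open>auto simp: in_keys_iff\<close>)

lemma monom_eval_add: "monom_eval v (m + m') = monom_eval v m * monom_eval v m'"
proof -
  let ?A = "Poly_Mapping.keys m \<union> Poly_Mapping.keys m'"
  have "Poly_Mapping.keys (m + m') \<subseteq> ?A" by (rule Poly_Mapping.keys_add)
  then show ?thesis
    by (simp add: monom_eval_superset[of ?A] lookup_add power_add prod.distrib)
qed

lemma poly_eval_superset:
  assumes "finite A" "Poly_Mapping.keys p \<subseteq> A"
  shows "poly_eval v p = (\<Sum>m\<in>A. Poly_Mapping.lookup p m * monom_eval v m)"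
  unfolding poly_eval_def
  by (rule sum.mono_neutral_left) (use assms in \<open>auto simp: in_keys_iff\<close>)

lemma poly_eval_add: "poly_eval v (p + q) = poly_eval v p + poly_eval v q"
proof -
  let ?A = "Poly_Mapping.keys p \<union> Poly_Mapping.keys q"
  have "Poly_Mapping.keys (p + q) \<subseteq> ?A" by (rule Poly_Mapping.keys_add)
  then have "poly_eval v (p + q) = (\<Sum>m\<in>?A. Poly_Mapping.lookup (p + q) m * monom_eval v m)"
    by (intro poly_eval_superset) auto
  also have "\<dots> = (\<Sum>m\<in>?A. Poly_Mapping.lookup p m * monom_eval v m)
      + (\<Sum>m\<in>?A. Poly_Mapping.lookup q m * monom_eval v m)"
    unfolding lookup_add distrib_right sum.distrib ..
  also have "\<dots> = poly_eval v p + poly_eval v q"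
    by (intro arg_cong2[of _ _ _ _ "(+)"] poly_eval_superset[symmetric]) auto
  finally show ?thesis .
qed

lemma poly_eval_0: "poly_eval v 0 = 0"
  by (simp add: poly_eval_def)

lemma poly_eval_single: "poly_eval v (Poly_Mapping.single m c) = c * monom_eval v m"
  by (simp add: poly_eval_def)

lemma cpoly_induct [case_names zero add_single]:
  fixes p :: "'x cpoly"
  assumes "P 0" "\<And>p m c. P p \<Longrightarrow> P (p + Poly_Mapping.single m c)"
  shows "P p"
proof (induction p rule: update_induct)
  case const
  show ?case by (rule assms(1))
next
  case (update f a b)
  have "Poly_Mapping.update a b f = f + Poly_Mapping.single a b"
    using update(1)
    by (intro poly_mapping_eqI) (auto simp: lookup_update lookup_add lookup_single in_keys_iff)
  with assms(2)[OF update(3)] show ?case by simp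
qed

lemma poly_eval_mult: "poly_eval v (p * q) = poly_eval v p * poly_eval v q"
proof (induction p rule: cpoly_induct)
  case zero
  show ?case by (simp add: poly_eval_0)
next
  case (add_single p m c)
  have "poly_eval v (Poly_Mapping.single m c * q) = c * monom_eval v m * poly_eval v q"
  proof (induction q rule: cpoly_induct)
    case zero
    show ?case by (simp add: poly_eval_0)
  next
    case (add_single q m' c')
    then show ?case
      by (simp add: distrib_left poly_eval_add mult_single poly_eval_single monom_eval_add)
  qed
  with add_single show ?case
    by (simp add: distrib_right poly_eval_add poly_eval_single)
qed

lemma poly_eval_1: "poly_eval v 1 = 1"
  by (simp add: poly_eval_single monom_eval_def flip: single_one)

lemma poly_eval_Var [simp]: "poly_eval v (Var x) = v x"
  by (simp add: Var_def poly_eval_single monom_eval_def)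

lemma poly_eval_scale [simp]: "poly_eval v (scale c p) = c * poly_eval v p"
  by (simp add: scale_def poly_eval_mult poly_eval_single monom_eval_def)

interpretation poly_eval: comm_ring_hom "poly_eval v"
  by unfold_locales (simp_all add: poly_eval_0 poly_eval_1 poly_eval_add poly_eval_mult)

lemma poly_eval_generic_det: "poly_eval x (generic_det n) = det (mat n n x)"
proof -
  have "map_mat (poly_eval x) (mat n n (\<lambda>(i, j). Var (i, j))) = mat n n x"
    by (rule eq_matI) auto
  then show ?thesis
    unfolding generic_det_def by (metis poly_eval.hom_det)
qed

section \<open>Linear forms and their symmetric powers\<close>

definition unit_at :: "'x \<Rightarrow> 'x \<Rightarrow> complex" where
  "unit_at s t = (if t = s then 1 else 0)"

lemma linear_form_expansion:
  assumes "finite S" "w \<in> cpoly.span (Var ` S)"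
  shows "w = (\<Sum>s\<in>S. scale (poly_eval (unit_at s) w) (Var s))"
  using assms(2)
proof (induction rule: cpoly.span_induct_alt)
  case base
  show ?case by simp
next
  case (step c y w)
  then obtain s where s: "s \<in> S" "y = Var s" by auto
  have "(\<Sum>t\<in>S. scale (poly_eval (unit_at t) (scale c y + w)) (Var t))
      = (\<Sum>t\<in>S. scale (c * unit_at t s) (Var t)) + w"
    using step(2)[symmetric] s by (simp add: poly_eval.hom_add cpoly.scale_left_distrib sum.distrib)
  also have "(\<Sum>t\<in>S. scale (c * unit_at t s) (Var t)) = (\<Sum>t\<in>S. if s = t then scale c (Var s) else 0)"
    by (rule sum.cong) (auto simp: unit_at_def)
  finally show ?case using s assms(1) by simp
qed

lemma poly_eval_linear_form:
  assumes "finite S" "w \<in> cpoly.span (Var ` S)"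
  shows "poly_eval x w = (\<Sum>s\<in>S. poly_eval (unit_at s) w * x s)"
  by (subst linear_form_expansion[OF assms]) (simp add: poly_eval.hom_sum)

lemma poly_eval_linear_form_add:
  assumes "finite S" "w \<in> cpoly.span (Var ` S)"
  shows "poly_eval (\<lambda>s. x s + y s) w = poly_eval x w + poly_eval y w"
  unfolding poly_eval_linear_form[OF assms, of x] poly_eval_linear_form[OF assms, of y]
    poly_eval_linear_form[OF assms, of "\<lambda>s. x s + y s"] distrib_left sum.distrib ..

lemma linear_form_eq_0:
  assumes "finite S" "w \<in> cpoly.span (Var ` S)" "\<And>x. poly_eval x w = 0"
  shows "w = 0"
  by (subst linear_form_expansion[OF assms(1,2)]) (simp add: assms(3))

lemma poly_eval_Sym_cong:
  assumes "F \<in> Sym d W" "\<And>w. w \<in> W \<Longrightarrow> poly_eval x w = poly_eval y w"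
  shows "poly_eval x F = poly_eval y F"
  using assms(1) unfolding Sym_def
proof (induction rule: cpoly.span_induct_alt)
  case base
  show ?case by simp
next
  case (step c p q)
  then obtain ws where ws: "p = prod_list ws" "set ws \<subseteq> W" by auto
  have "poly_eval x (prod_list ws) = poly_eval y (prod_list ws)"
    using ws(2) by (induction ws) (auto simp: poly_eval.hom_mult assms(2))
  with step(2) ws(1) show ?case by (simp add: poly_eval.hom_add)
qed

text \<open>For \<open>d = 0\<close> the empty product \<open>1\<close> would be a nonzero element.\<close>

lemma Sym_trivial:
  assumes "F \<in> Sym d W" "W \<subseteq> {0}" "d > 0"
  shows "F = 0"
  using assms(1) unfolding Sym_def
proof (induction rule: cpoly.span_induct_alt)
  case base
  show ?case ..
next
  case (step c p q)
  then obtain ws where "p = prod_list ws" "length ws = d" "set ws \<subseteq> W" by auto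
  then have "p = 0" using assms(2,3) by (cases ws) auto
  with step(2) show ?case by simp
qed

text \<open>
  The forms \<open>u s\<close> are the images of the variables under the projection onto \<open>V1\<close> along \<open>V2\<close>; the
  point \<open>\<lambda>s. poly_eval x (u s)\<close> is the image of \<open>x\<close> under the dual projection. Stating the result
  by evaluation avoids a construction of dual spaces.
\<close>

lemma dual_projection:
  assumes sum: "internal_direct_sum (cpoly.span (Var ` S)) V1 V2"
  obtains u where "\<And>s. s \<in> S \<Longrightarrow> u s \<in> V1"
    and "\<And>x w. w \<in> V1 \<Longrightarrow> poly_eval (\<lambda>s. poly_eval x (u s)) w = poly_eval x w"
    and "\<And>x w. w \<in> V2 \<Longrightarrow> poly_eval (\<lambda>s. poly_eval x (u s)) w = 0"
proof -
  let ?V = "cpoly.span (Var ` S)"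
  have V1: "cpoly.subspace V1" and V2: "cpoly.subspace V2"
    and V: "?V = {u + v | u v. u \<in> V1 \<and> v \<in> V2}" and int: "V1 \<inter> V2 = {0}"
    using sum by (auto simp: internal_direct_sum_def)
  have "\<forall>s\<in>S. \<exists>u\<in>V1. Var s - u \<in> V2"
  proof
    fix s assume "s \<in> S"
    then have "Var s \<in> ?V" by (auto intro: cpoly.span_base)
    then obtain u v where "u \<in> V1" "v \<in> V2" "Var s = u + v" unfolding V by auto
    then show "\<exists>u\<in>V1. Var s - u \<in> V2" by (intro bexI[of _ u]) auto
  qed
  then obtain u where u: "\<And>s. s \<in> S \<Longrightarrow> u s \<in> V1" "\<And>s. s \<in> S \<Longrightarrow> Var s - u s \<in> V2"
    by metis
  \<comment> \<open>The form \<open>u'\<close> is the \<open>V1\<close>-component of \<open>w\<close>.\<close>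
  have proj: "\<exists>u'\<in>V1. w - u' \<in> V2 \<and> (\<forall>x. poly_eval (\<lambda>s. poly_eval x (u s)) w = poly_eval x u')"
    if "w \<in> ?V" for w
    using that
  proof (induction rule: cpoly.span_induct_alt)
    case base
    show ?case using cpoly.subspace_0[OF V1] cpoly.subspace_0[OF V2]
      by (intro bexI[of _ 0]) auto
  next
    case (step c y w)
    from step(1) obtain s where s: "s \<in> S" "y = Var s" by auto
    from step(2) obtain u' where u': "u' \<in> V1" "w - u' \<in> V2"
      "\<And>x. poly_eval (\<lambda>s. poly_eval x (u s)) w = poly_eval x u'" by auto
    have "scale c y + w - (scale c (u s) + u') = scale c (Var s - u s) + (w - u')"
      using s by (simp add: cpoly.scale_right_diff_distrib)
    also have "\<dots> \<in> V2"
      by (intro cpoly.subspace_add cpoly.subspace_scale V2 u(2) s u'(2))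
    finally have "scale c y + w - (scale c (u s) + u') \<in> V2" .
    moreover have "scale c (u s) + u' \<in> V1"
      by (intro cpoly.subspace_add cpoly.subspace_scale V1 u(1) s u'(1))
    ultimately show ?case
      using s u'(3) by (intro bexI[of _ "scale c (u s) + u'"]) (auto simp: poly_eval.hom_add)
  qed
  show thesis
  proof (rule that[of u])
    show "u s \<in> V1" if "s \<in> S" for s using u(1) that .
  next
    fix x w assume w: "w \<in> V1"
    then have "w \<in> ?V" unfolding V using cpoly.subspace_0[OF V2] by force
    from proj[OF this] obtain u' where u': "u' \<in> V1" "w - u' \<in> V2"
      "\<And>x. poly_eval (\<lambda>s. poly_eval x (u s)) w = poly_eval x u'" by auto
    have "w - u' \<in> V1 \<inter> V2" using cpoly.subspace_diff[OF V1 w u'(1)] u'(2) by auto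
    then show "poly_eval (\<lambda>s. poly_eval x (u s)) w = poly_eval x w"
      using u'(3) unfolding int by simp
  next
    fix x w assume w: "w \<in> V2"
    then have "w \<in> ?V" unfolding V using cpoly.subspace_0[OF V1] by force
    from proj[OF this] obtain u' where u': "u' \<in> V1" "w - u' \<in> V2"
      "\<And>x. poly_eval (\<lambda>s. poly_eval x (u s)) w = poly_eval x u'" by auto
    have "w - (w - u') \<in> V2" by (rule cpoly.subspace_diff[OF V2 w u'(2)])
    then have "u' \<in> V1 \<inter> V2" using u'(1) by auto
    then show "poly_eval (\<lambda>s. poly_eval x (u s)) w = 0"
      using u'(3) unfolding int by simp
  qed
qed

section \<open>Mixed differences of the determinant\<close>

lemma det_scale_rows:
  "det (mat n n (\<lambda>(r, s). d r * f (r, s))) = (\<Prod>r = 0..<n. d r) * det (mat n n f)"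
proof -
  have "(\<Prod>r = 0..<n. mat n n (\<lambda>(r, s). d r * f (r, s)) $$ (r, p r))
      = (\<Prod>r = 0..<n. d r) * (\<Prod>r = 0..<n. mat n n f $$ (r, p r))"
    if "p permutes {0..<n}" for p
  proof -
    have "p r < n" if "r < n" for r
      using permutes_in_image[OF \<open>p permutes {0..<n}\<close>, of r] that by simp
    then show ?thesis by (simp flip: prod.distrib)
  qed
  then show ?thesis
    by (simp add: det_def sum_distrib_left mult.left_commute cong: sum.cong_simp)
qed

lemma permutes_with_two_values:
  assumes "i \<in> A" "k \<in> A" "j \<in> A" "l \<in> A" "i \<noteq> k" "j \<noteq> l"
  obtains \<sigma> where "\<sigma> permutes A" "\<sigma> i = j" "\<sigma> k = l"
proof
  let ?\<tau> = "transpose i j"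
  have \<tau>: "?\<tau> permutes A" by (rule permutes_swap_id) (use assms in auto)
  then have \<tau>k: "?\<tau> k \<in> A" using assms permutes_in_image by metis
  show "transpose l (?\<tau> k) \<circ> ?\<tau> permutes A"
    by (intro permutes_compose \<tau> permutes_swap_id \<tau>k assms)
  have "?\<tau> k \<noteq> j" using assms by (auto simp: transpose_def)
  with assms(6) show "(transpose l (?\<tau> k) \<circ> ?\<tau>) i = j" by (simp add: transpose_def)
  show "(transpose l (?\<tau> k) \<circ> ?\<tau>) k = l" by simp
qed

lemma permutes_eq_off_two:
  assumes "p permutes A" "\<sigma> permutes A" "i \<noteq> k" "i \<in> A" "k \<in> A"
    and eq: "\<And>r. r \<in> A - {i, k} \<Longrightarrow> p r = \<sigma> r"
  shows "p = \<sigma> \<or> p = \<sigma> \<circ> transpose i k"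
proof -
  define q where "q = inv_into UNIV \<sigma> \<circ> p"
  have "q permutes A" unfolding q_def
    by (intro permutes_compose permutes_inv assms)
  moreover have "q r = r" if "r \<in> A - {i, k}" for r
    using eq[OF that] permutes_inverses(2)[OF assms(2)] by (simp add: q_def)
  ultimately have "q permutes {i, k}"
    by (rule permutes_superset) auto
  then have "q = id \<or> q = transpose i k"
    by (simp add: permutes_doubleton_iff)
  moreover have "p = \<sigma> \<circ> q"
    unfolding q_def using permutes_inv_o(1)[OF assms(2)] by (simp add: o_assoc)
  ultimately show ?thesis by auto
qed

text \<open>
  Only \<open>\<sigma>\<close> and \<open>\<sigma>\<close> preceded by the transposition of \<open>i\<close> and \<open>k\<close> contribute to the Leibniz
  expansion, because any other permutation meets a zero in a row different from \<open>i\<close> and \<open>k\<close>.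
\<close>

lemma det_partial_permutation:
  fixes c :: "nat \<times> nat \<Rightarrow> complex"
  assumes \<sigma>: "\<sigma> permutes {0..<n}" and ik: "i < n" "k < n" "i \<noteq> k"
  shows "det (mat n n (\<lambda>(r, s). if r = i \<or> r = k then c (r, s) else if s = \<sigma> r then 1 else 0))
    = signof \<sigma> * (c (i, \<sigma> i) * c (k, \<sigma> k) - c (i, \<sigma> k) * c (k, \<sigma> i))" (is "det ?M = _")
proof -
  let ?\<sigma>' = "\<sigma> \<circ> transpose i k"
  let ?t = "\<lambda>p. signof p * (\<Prod>r = 0..<n. ?M $$ (r, p r))"
  have \<sigma>': "?\<sigma>' permutes {0..<n}"
    by (intro permutes_compose permutes_swap_id \<sigma>) (use ik in auto)
  have ne: "\<sigma> \<noteq> ?\<sigma>'"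
  proof
    assume "\<sigma> = ?\<sigma>'"
    then have "\<sigma> i = \<sigma> k" by (metis comp_apply transpose_apply_first)
    then show False using permutes_inj[OF \<sigma>] ik(3) by (auto dest: injD)
  qed
  have lt: "p r < n" if "p permutes {0..<n}" "r < n" for p r
    using permutes_in_image[OF that(1), of r] that(2) by simp
  have zero: "?t p = 0" if p: "p permutes {0..<n}" and p_ne: "p \<noteq> \<sigma>" "p \<noteq> ?\<sigma>'" for p
  proof -
    obtain r where r: "r \<in> {0..<n} - {i, k}" "p r \<noteq> \<sigma> r"
      using permutes_eq_off_two[OF p \<sigma> ik(3)] ik p_ne by auto
    then have "?M $$ (r, p r) = 0" using lt[OF p] by simp
    then have "(\<Prod>r = 0..<n. ?M $$ (r, p r)) = 0" using r by (intro prod_zero) auto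
    then show ?thesis by simp
  qed
  have two: "(\<Prod>r = 0..<n. ?M $$ (r, p r)) = c (i, p i) * c (k, p k)"
    if p: "p permutes {0..<n}" and eq: "\<And>r. r \<noteq> i \<Longrightarrow> r \<noteq> k \<Longrightarrow> p r = \<sigma> r" for p
  proof -
    have "(\<Prod>r = 0..<n. ?M $$ (r, p r)) = (\<Prod>r\<in>{i, k}. ?M $$ (r, p r))"
    proof (rule prod.mono_neutral_right)
      show "\<forall>r\<in>{0..<n} - {i, k}. ?M $$ (r, p r) = 1"
      proof
        fix r assume r: "r \<in> {0..<n} - {i, k}"
        then show "?M $$ (r, p r) = 1" using lt[OF p, of r] eq[of r] by simp
      qed
    qed (use ik in auto)
    then show ?thesis using ik lt[OF p] by simp
  qed
  have sign': "sign ?\<sigma>' = - sign \<sigma>"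
    using ik(3) \<sigma> by (subst sign_compose)
      (auto simp: sign_swap_id permutation_swap_id intro: permutes_imp_permutation[of "{0..<n}"])
  have "det ?M = (\<Sum>p | p permutes {0..<n}. ?t p)"
    by (rule det_def') simp
  also have "\<dots> = (\<Sum>p\<in>{\<sigma>, ?\<sigma>'}. ?t p)"
    by (rule sum.mono_neutral_right) (use zero \<sigma> \<sigma>' in \<open>auto simp: finite_permutations\<close>)
  also have "\<dots> = ?t \<sigma> + ?t ?\<sigma>'" using ne by simp
  also have "\<dots> = signof \<sigma> * (c (i, \<sigma> i) * c (k, \<sigma> k) - c (i, \<sigma> k) * c (k, \<sigma> i))"
    using two[OF \<sigma>] two[OF \<sigma>'] sign' by (simp add: transpose_def right_diff_distrib)
  finally show ?thesis .
qed

text \<open>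
  Multiplying by \<open>h\<close> all rows except \<open>i\<close> and \<open>k\<close> turns \<open>x + c\<close>, for \<open>x\<close> the partial permutation
  matrix divided by \<open>h\<close>, into a matrix that depends polynomially on \<open>h\<close>, and whose determinant at
  \<open>h = 0\<close> is a minor of \<open>c\<close>. The difference identity for \<open>det\<close> is therefore inherited by the minor.
\<close>

lemma polarised_minor_eq_0:
  fixes a b :: "nat \<times> nat \<Rightarrow> complex"
  assumes add: "\<And>x. det (mat n n (\<lambda>s. x s + a s + b s)) + det (mat n n x)
      = det (mat n n (\<lambda>s. x s + a s)) + det (mat n n (\<lambda>s. x s + b s))"
    and ik: "i < n" "k < n" "i \<noteq> k" and jl: "j < n" "l < n" "j \<noteq> l"
  shows "a (i, j) * b (k, l) + a (k, l) * b (i, j) - a (i, l) * b (k, j) - a (k, j) * b (i, l) = 0"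
proof -
  obtain \<sigma> where \<sigma>: "\<sigma> permutes {0..<n}" "\<sigma> i = j" "\<sigma> k = l"
    using permutes_with_two_values[of i "{0..<n}" k j l] ik jl by auto
  define Y :: "complex \<Rightarrow> (nat \<times> nat \<Rightarrow> complex) \<Rightarrow> complex" where
    "Y h c = det (mat n n (\<lambda>(r, s). if r = i \<or> r = k then c (r, s)
        else (if s = \<sigma> r then 1 else 0) + h * c (r, s)))" for h c
  have Y0: "Y 0 c = signof \<sigma> * (c (i, j) * c (k, l) - c (i, l) * c (k, j))" for c
  proof -
    have "Y 0 c = det (mat n n (\<lambda>(r, s). if r = i \<or> r = k then c (r, s)
        else if s = \<sigma> r then 1 else 0))"
      unfolding Y_def by (rule arg_cong[where f = det], rule eq_matI) auto
    then show ?thesis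
      using det_partial_permutation[OF \<sigma>(1) ik, of c] \<sigma>(2,3) by simp
  qed
  have lim: "((\<lambda>h. Y h c) \<longlongrightarrow> Y 0 c) (at 0)" for c
  proof -
    have *: "((\<lambda>h. mat n n (\<lambda>(r, s). if r = i \<or> r = k then c (r, s)
            else (if s = \<sigma> r then 1 else 0) + h * c (r, s)) $$ (r, p r))
        \<longlongrightarrow> mat n n (\<lambda>(r, s). if r = i \<or> r = k then c (r, s)
            else (if s = \<sigma> r then 1 else 0) + 0 * c (r, s)) $$ (r, p r)) (at 0)"
      if "p permutes {0..<n}" "r < n" for p r
    proof -
      have "p r < n" using permutes_in_image[OF that(1), of r] that(2) by simp
      then show ?thesis using that(2)
        by (cases "r = i \<or> r = k") (auto intro!: tendsto_eq_intros)
    qed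
    show ?thesis
      unfolding Y_def det_def'[OF mat_carrier]
      by (intro tendsto_sum tendsto_mult tendsto_const tendsto_prod *) auto
  qed
  have Yh: "Y h (\<lambda>s. a s + b s) + Y h (\<lambda>_. 0) = Y h a + Y h b" if h: "h \<noteq> 0" for h
  proof -
    define d where "d r = (if r = i \<or> r = k then 1 else h)" for r
    define x where "x = (\<lambda>(r, s). if r = i \<or> r = k then 0 else (if s = \<sigma> r then 1 else 0) / h)"
    have "Y h c = (\<Prod>r = 0..<n. d r) * det (mat n n (\<lambda>s. x s + c s))" for c
      unfolding Y_def det_scale_rows[symmetric]
      by (rule arg_cong[where f = det], rule eq_matI)
        (use h in \<open>auto simp: d_def x_def distrib_left\<close>)
    then show ?thesis
      using add[of x] by (simp add: add.assoc flip: distrib_left)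
  qed
  have "((\<lambda>h. Y h (\<lambda>s. a s + b s) + Y h (\<lambda>_. 0) - (Y h a + Y h b)) \<longlongrightarrow>
      Y 0 (\<lambda>s. a s + b s) + Y 0 (\<lambda>_. 0) - (Y 0 a + Y 0 b)) (at 0)"
    by (intro tendsto_intros lim)
  moreover have "((\<lambda>h. Y h (\<lambda>s. a s + b s) + Y h (\<lambda>_. 0) - (Y h a + Y h b)) \<longlongrightarrow> 0) (at 0)"
    by (rule tendsto_eventually) (auto simp: eventually_at_filter Yh)
  ultimately have "Y 0 (\<lambda>s. a s + b s) + Y 0 (\<lambda>_. 0) - (Y 0 a + Y 0 b) = 0"
    by (rule tendsto_unique[rotated]) simp
  then have "signof \<sigma> * (a (i, j) * b (k, l) + a (k, l) * b (i, j)
      - a (i, l) * b (k, j) - a (k, j) * b (i, l)) = (0 :: complex)"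
    unfolding Y0 by (simp add: algebra_simps)
  then show ?thesis by (auto simp: sign_def split: if_splits)
qed

section \<open>Maps self-adjoint for every minor\<close>

text \<open>
  Positions \<open>(i, j)\<close> and \<open>(k, l)\<close> in different rows and columns determine a \<open>2 \<times> 2\<close> minor, a
  quadratic form in the matrix entries. This is its polarisation.
\<close>

definition polar_minor ::
    "nat \<times> nat \<Rightarrow> nat \<times> nat \<Rightarrow> (nat \<times> nat \<Rightarrow> complex) \<Rightarrow> (nat \<times> nat \<Rightarrow> complex) \<Rightarrow> complex" where
  "polar_minor = (\<lambda>(i, j) (k, l) a b.
     a (i, j) * b (k, l) + a (k, l) * b (i, j) - a (i, l) * b (k, j) - a (k, j) * b (i, l))"

lemma polar_minor_commute: "polar_minor s t a b = polar_minor s t b a"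
  by (cases s; cases t) (simp add: polar_minor_def algebra_simps)

lemma polar_minor_diff_right:
  "polar_minor s t a (\<lambda>r. b r - c r) = polar_minor s t a b - polar_minor s t a c"
  by (cases s; cases t) (simp add: polar_minor_def algebra_simps)

lemma polar_minor_unit_at:
  assumes "i \<noteq> k" "j \<noteq> l"
  shows "polar_minor (i, j) (k, l) a (unit_at (k, l)) = a (i, j)"
  using assms by (simp add: polar_minor_def unit_at_def)

text \<open>
  The form \<open>polar_minor s t\<close> reads off the entry at \<open>s\<close> when its second argument is the matrix unit
  at \<open>t\<close>. With a first argument \<open>P (unit_at (i, j))\<close>, self-adjointness moves \<open>P\<close> to the other side
  and leaves the matrix unit at \<open>(i, j)\<close>, which the form annihilates as soon as \<open>(i, j)\<close> lies
  outside the rows or outside the columns of the minor. A third row and a third column provide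
  enough such minors.
\<close>

lemma self_adjoint_for_minors_imp_scalar:
  fixes P :: "(nat \<times> nat \<Rightarrow> complex) \<Rightarrow> (nat \<times> nat \<Rightarrow> complex)"
  assumes n: "n > 2"
    and adj: "\<And>i j k l a b. \<lbrakk>i < n; j < n; k < n; l < n; i \<noteq> k; j \<noteq> l\<rbrakk> \<Longrightarrow>
      polar_minor (i, j) (k, l) (P a) b = polar_minor (i, j) (k, l) a (P b)"
  obtains \<mu> where "\<And>s t. \<lbrakk>s \<in> {..<n} \<times> {..<n}; t \<in> {..<n} \<times> {..<n}\<rbrakk> \<Longrightarrow>
    P (unit_at s) t = \<mu> * unit_at s t"
proof -
  have avoid: "\<exists>r < n. r \<noteq> p \<and> r \<noteq> q" for p q :: nat
  proof -
    have "card {p, q} < card {..<n}" using n card_insert_le_m1[of 2 "{q}" p] by simp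
    then have "\<not> {..<n} \<subseteq> {p, q}" by (metis card_mono finite.emptyI finite_insert not_less)
    then show ?thesis by auto
  qed
  have off_diag: "P (unit_at (i, j)) (p, q) = 0"
    if "i < n" "j < n" "p < n" "q < n" "(p, q) \<noteq> (i, j)" for i j p q
  proof -
    \<comment> \<open>The minor on rows \<open>p, p'\<close> and columns \<open>q, q'\<close> does not involve the entry \<open>(i, j)\<close>.\<close>
    obtain p' q' where pq: "p' < n" "q' < n" "p' \<noteq> p" "q' \<noteq> q"
      and disj: "(p \<noteq> i \<and> p' \<noteq> i) \<or> (q \<noteq> j \<and> q' \<noteq> j)"
    proof (cases "p = i")
      case False
      then show thesis using avoid[of p i] avoid[of q q] that by metis
    next
      case True
      then have "q \<noteq> j" using \<open>(p, q) \<noteq> (i, j)\<close> by simp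
      then show thesis using avoid[of p p] avoid[of q j] that by metis
    qed
    have "P (unit_at (i, j)) (p, q) = polar_minor (p, q) (p', q') (P (unit_at (i, j))) (unit_at (p', q'))"
      using pq by (intro polar_minor_unit_at[symmetric]) auto
    also have "\<dots> = polar_minor (p, q) (p', q') (unit_at (i, j)) (P (unit_at (p', q')))"
      by (rule adj) (use that pq in auto)
    also have "\<dots> = 0"
      using disj by (auto simp: polar_minor_def unit_at_def)
    finally show ?thesis .
  qed
  have diag: "P (unit_at (k, l)) (k, l) = P (unit_at (i, j)) (i, j)"
    if "i < n" "j < n" "k < n" "l < n" "i \<noteq> k" "j \<noteq> l" for i j k l
  proof -
    have "P (unit_at (i, j)) (i, j) = polar_minor (i, j) (k, l) (P (unit_at (i, j))) (unit_at (k, l))"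
      using that by (intro polar_minor_unit_at[symmetric]) auto
    also have "\<dots> = polar_minor (i, j) (k, l) (unit_at (i, j)) (P (unit_at (k, l)))"
      by (rule adj) (use that in auto)
    also have "\<dots> = P (unit_at (k, l)) (k, l)"
      using that by (simp add: polar_minor_def unit_at_def)
    finally show ?thesis ..
  qed
  have diag': "P (unit_at (k, l)) (k, l) = P (unit_at (0, 0)) (0, 0)" if "k < n" "l < n" for k l
  proof -
    \<comment> \<open>The position \<open>(r, s)\<close> shares no row or column with \<open>(k, l)\<close> or with \<open>(0, 0)\<close>.\<close>
    obtain r where r: "r < n" "r \<noteq> k" "r \<noteq> 0" using avoid[of k 0] by auto
    obtain s where s: "s < n" "s \<noteq> l" "s \<noteq> 0" using avoid[of l 0] by auto
    show ?thesis using diag[of r s k l] diag[of r s 0 0] r s that n by simp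
  qed
  show thesis
  proof (rule that[of "P (unit_at (0, 0)) (0, 0)"])
    fix s t :: "nat \<times> nat"
    assume st: "s \<in> {..<n} \<times> {..<n}" "t \<in> {..<n} \<times> {..<n}"
    show "P (unit_at s) t = P (unit_at (0, 0)) (0, 0) * unit_at s t"
    proof (cases "t = s")
      case True
      then show ?thesis using st diag'[of "fst s" "snd s"] by (auto simp: unit_at_def)
    next
      case False
      then show ?thesis
        using st off_diag[of "fst s" "snd s" "fst t" "snd t"] by (auto simp: unit_at_def)
    qed
  qed
qed

lemma mixed_additive_det_imp_scalar:
  fixes P :: "(nat \<times> nat \<Rightarrow> complex) \<Rightarrow> (nat \<times> nat \<Rightarrow> complex)"
  assumes n: "n > 2"
    and add: "\<And>x a b. det (mat n n (\<lambda>s. x s + P a s + (b s - P b s))) + det (mat n n x)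
      = det (mat n n (\<lambda>s. x s + P a s)) + det (mat n n (\<lambda>s. x s + (b s - P b s)))"
  obtains \<mu> where "\<And>s t. \<lbrakk>s \<in> {..<n} \<times> {..<n}; t \<in> {..<n} \<times> {..<n}\<rbrakk> \<Longrightarrow>
    P (unit_at s) t = \<mu> * unit_at s t"
proof (rule self_adjoint_for_minors_imp_scalar[OF n, of P])
  fix i j k l a b
  assume "i < n" "j < n" "k < n" "l < n" "i \<noteq> k" "j \<noteq> l"
  then have "polar_minor (i, j) (k, l) (P a) (\<lambda>s. b s - P b s) = 0" for a b
    unfolding polar_minor_def split by (intro polarised_minor_eq_0[where n = n] add)
  then have *: "polar_minor (i, j) (k, l) (P a) b = polar_minor (i, j) (k, l) (P a) (P b)" for a b
    by (simp add: polar_minor_diff_right)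
  \<comment> \<open>The right-hand side of the last identity is symmetric in \<open>a\<close> and \<open>b\<close>.\<close>
  show "polar_minor (i, j) (k, l) (P a) b = polar_minor (i, j) (k, l) a (P b)"
    using *[of a b] *[of b a] by (metis polar_minor_commute)
qed (use that in blast)

section \<open>Indecomposability\<close>

theorem corollary1p2:
  fixes n :: nat
  assumes "n > 2"
  shows "\<not> is_direct_sum n (matrix_forms n) (generic_det n)"
proof
  let ?S = "{..<n} \<times> {..<n}"
  let ?V = "cpoly.span (Var ` ?S)"
  assume "is_direct_sum n (matrix_forms n) (generic_det n)"
  then obtain V1 V2 F1 F2 where sum: "internal_direct_sum ?V V1 V2"
    and F1: "F1 \<in> Sym n V1" "F1 \<noteq> 0" and F2: "F2 \<in> Sym n V2" "F2 \<noteq> 0"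
    and F: "generic_det n = F1 + F2"
    unfolding is_direct_sum_def matrix_forms_def by auto
  have fin: "finite ?S" by simp
  have V: "?V = {v + w | v w. v \<in> V1 \<and> w \<in> V2}" and "0 \<in> V1" "0 \<in> V2"
    using sum cpoly.subspace_0 unfolding internal_direct_sum_def by auto
  then have V1: "V1 \<subseteq> ?V" and V2: "V2 \<subseteq> ?V"
    unfolding V by force+
  obtain u where u: "\<And>s. s \<in> ?S \<Longrightarrow> u s \<in> V1"
    and u1: "\<And>x w. w \<in> V1 \<Longrightarrow> poly_eval (\<lambda>s. poly_eval x (u s)) w = poly_eval x w"
    and u2: "\<And>x w. w \<in> V2 \<Longrightarrow> poly_eval (\<lambda>s. poly_eval x (u s)) w = 0"
    by (rule dual_projection[OF sum]) blast
  define P where "P x s = poly_eval x (u s)" for x s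
  have P1: "poly_eval (P x) w = poly_eval x w" if "w \<in> V1" for x w
    using u1[OF that] by (simp add: P_def[abs_def])
  have P2: "poly_eval (P x) w = 0" if "w \<in> V2" for x w
    using u2[OF that] by (simp add: P_def[abs_def])
  have plus: "poly_eval (\<lambda>s. x s + y s) w = poly_eval x w + poly_eval y w" if "w \<in> ?V" for x y w
    by (rule poly_eval_linear_form_add[OF fin that])
  have inv1: "poly_eval (\<lambda>s. x s + (b s - P b s)) F1 = poly_eval x F1" for x b
  proof (rule poly_eval_Sym_cong[OF F1(1)])
    fix w assume w: "w \<in> V1"
    then have wV: "w \<in> ?V" using V1 by blast
    \<comment> \<open>A form in \<open>V1\<close> takes the same value at \<open>b\<close> and at \<open>P b\<close>, so it vanishes at \<open>b - P b\<close>.\<close>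
    have "poly_eval b w = poly_eval (\<lambda>s. b s - P b s) w + poly_eval (P b) w"
      by (subst plus[OF wV, symmetric]) simp
    then show "poly_eval (\<lambda>s. x s + (b s - P b s)) w = poly_eval x w"
      using P1[OF w] plus[OF wV] by simp
  qed
  have inv2: "poly_eval (\<lambda>s. x s + P a s) F2 = poly_eval x F2" for x a
  proof (rule poly_eval_Sym_cong[OF F2(1)])
    fix w assume w: "w \<in> V2"
    then show "poly_eval (\<lambda>s. x s + P a s) w = poly_eval x w"
      using P2[OF w] plus V2 by (simp add: subset_iff)
  qed
  have det: "det (mat n n x) = poly_eval x F1 + poly_eval x F2" for x
    by (simp add: F poly_eval.hom_add flip: poly_eval_generic_det)
  have mixed: "det (mat n n (\<lambda>s. x s + P a s + (b s - P b s))) + det (mat n n x)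
      = det (mat n n (\<lambda>s. x s + P a s)) + det (mat n n (\<lambda>s. x s + (b s - P b s)))" for x a b
  proof -
    have "poly_eval (\<lambda>s. x s + P a s + (b s - P b s)) F2 = poly_eval (\<lambda>s. x s + (b s - P b s)) F2"
      using inv2[of "\<lambda>s. x s + (b s - P b s)" a] by (simp add: algebra_simps)
    then show ?thesis
      using inv1[of "\<lambda>s. x s + P a s" b] inv1[of x b] inv2[of x a] unfolding det by simp
  qed
  obtain \<mu> where unit: "\<And>s t. s \<in> ?S \<Longrightarrow> t \<in> ?S \<Longrightarrow> P (unit_at s) t = \<mu> * unit_at s t"
    by (rule mixed_additive_det_imp_scalar[of n P, OF assms mixed]) blast
  have scalar: "P x t = \<mu> * x t" if t: "t \<in> ?S" for x t
  proof -
    have "u t \<in> ?V" using u[OF t] V1 by blast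
    then have "P x t = (\<Sum>s\<in>?S. P (unit_at s) t * x s)"
      unfolding P_def by (rule poly_eval_linear_form[OF fin])
    also have "\<dots> = (\<Sum>s\<in>?S. if t = s then \<mu> * x t else 0)"
      by (rule sum.cong) (use t in \<open>auto simp: unit unit_at_def\<close>)
    finally show ?thesis using t by simp
  qed
  have evalP: "poly_eval (P x) w = \<mu> * poly_eval x w" if "w \<in> ?V" for x w
    unfolding poly_eval_linear_form[OF fin that, of "P x"] poly_eval_linear_form[OF fin that, of x]
      sum_distrib_left
    by (rule sum.cong) (use scalar in auto)
  show False
  proof (cases "\<mu> = 0")
    case True
    have "w = 0" if "w \<in> V1" for w
    proof (rule linear_form_eq_0[OF fin])
      show "w \<in> ?V" using that V1 by blast
      then show "poly_eval x w = 0" for x using evalP[of w x] P1[OF that, of x] True by simp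
    qed
    then show False using Sym_trivial[OF F1(1)] F1(2) assms by auto
  next
    case False
    have "w = 0" if "w \<in> V2" for w
    proof (rule linear_form_eq_0[OF fin])
      show "w \<in> ?V" using that V2 by blast
      then show "poly_eval x w = 0" for x using evalP[of w x] P2[OF that, of x] False by simp
    qed
    then show False using Sym_trivial[OF F2(1)] F2(2) assms by auto
  qed
qed

end
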